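(* Let $W=(w_{i,j})\in\mathbb{R}_+^{n\times k}$ and $\ell\in\mathbb{R}_+^k$. Consider any $j\in[k]$ and let $f_j(z)=\max\{\ell_j,\max_{i\in[n]}\{w_{i,j}z_i\}\}$ for $z\in\{0,1\}^n$. Then, for every extreme point $\pi$ of $EP_{\tilde f_j}$, there exists a $j$-mixing-sequence $\{j_1\to\cdots\to j_\tau\}$ in $[n]$ that satisfies the following: (1) $w_{j_1,j}=\max\{w_{i,j}:i\in[n]\}$; (2) the corresponding polymatroid inequality $y_j+\sum_{i\in[n]}\pi_iz_i\ge\ell_j+\sum_{i\in[n]}\pi_i$ is equivalent to the mixing inequality derived from the sequence $\{j_1\to\cdots\to j_\tau\}$. In particular, for any $j\in[k]$, the extremal polymatroid inequality is of the form $$y_j+\sum_{s\in[\tau]}(w_{j_s,j}-w_{j_{s+1},j})z_{j_s}\ge\max\{w_{i,j}:i\in[n]\},$$ where $w_{j_1,j}=\max\{w_{i,j}:i\in[n]\}$ and $w_{j_{\tau+1},j}:=\ell_j$.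
   Context: $n,k\ge1$ are integers and $[n]=\{1,\dots,n\}$. For $f:\{0,1\}^n\to\mathbb{R}$ and $V\subseteq[n]$ write $f(V)=f(\mathbf 1_V)$ with $\mathbf 1_V$ the characteristic vector, and $\tilde f=f-f(\emptyset)$. The extended polymatroid is $EP_{\tilde f}=\{\pi\in\mathbb{R}^n:\sum_{i\in V}\pi_i\le\tilde f(V)\ \forall V\subseteq[n]\}$. Note $f_j(\emptyset)=\ell_j$. The polymatroid inequality of $f_j$ for $\pi\in EP_{\tilde f_j}$, written in the complemented variables $\mathbf 1-z$, is $y_j+\sum_i\pi_iz_i\ge\ell_j+\sum_i\pi_i$; it is extremal if $\pi$ is an extreme point of $EP_{\tilde f_j}$. A $j$-mixing-sequence is a sequence $\{j_1\to\cdots\to j_\tau\}$ of indices in $[n]$ with $w_{j_1,j}\ge w_{j_2,j}\ge\cdots\ge w_{j_\tau,j}\ge\ell_j$. The mixing inequality derived from it, with the convention $w_{j_{\tau+1},j}:=\ell_j$, is $y_j+\sum_{s\in[\tau]}(w_{j_s,j}-w_{j_{s+1},j})z_{j_s}\ge w_{j_1,j}$.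
   Formalization: The formal statement assumes ℓ_j ≤ max{w_{i,j} : i∈[n]} for the given j; otherwise f_j is constant, π = 0 is an extreme point, and no j-mixing-sequence exists (e.g. n = k = 1, w = 0, ℓ = 1). *)

theory Defs
  imports "HOL-Analysis.Analysis"
begin

text \<open>
  The index sets \<open>[n]\<close> and \<open>[k]\<close> are finite types \<open>'n\<close> and \<open>'k\<close>; an \<open>n \<times> k\<close> matrix \<open>W\<close> has type
  \<open>real ^ 'k ^ 'n\<close> and entries \<open>W $ i $ j\<close>.  A function on \<open>{0,1}\<^sup>n\<close> is given as a total function on
  \<open>real ^ 'n\<close>, of which only the values at characteristic vectors are ever used.
\<close>

definition char_vec :: "'n set \<Rightarrow> real ^ 'n::finite"
  where "char_vec V = (\<chi> i. indicator V i)"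

definition normalized :: "(real ^ 'n::finite \<Rightarrow> real) \<Rightarrow> real ^ 'n \<Rightarrow> real"
  where "normalized f z = f z - f (char_vec {})"

definition extended_polymatroid :: "(real ^ 'n::finite \<Rightarrow> real) \<Rightarrow> (real ^ 'n) set"
  where "extended_polymatroid f = {\<pi>. \<forall>V. (\<Sum>i\<in>V. \<pi> $ i) \<le> f (char_vec V)}"

definition mixing_fun :: "real ^ 'k::finite ^ 'n::finite \<Rightarrow> real ^ 'k \<Rightarrow> 'k \<Rightarrow> real ^ 'n \<Rightarrow> real"
  where "mixing_fun W l j z = max (l $ j) (MAX i. W $ i $ j * z $ i)"

text \<open>The inequality in the complemented variables; \<open>l $ j\<close> is the value of \<open>mixing_fun W l j\<close> at
  the empty set.\<close>

definition polymatroid_inequality ::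
    "real ^ 'k::finite \<Rightarrow> 'k \<Rightarrow> real ^ 'n::finite \<Rightarrow> real ^ 'k \<Rightarrow> real ^ 'n \<Rightarrow> bool"
  where "polymatroid_inequality l j \<pi> y z \<longleftrightarrow>
    y $ j + (\<Sum>i\<in>UNIV. \<pi> $ i * z $ i) \<ge> l $ j + (\<Sum>i\<in>UNIV. \<pi> $ i)"

text \<open>A sequence \<open>j\<^sub>1 \<rightarrow> \<dots> \<rightarrow> j\<^sub>\<tau>\<close> is a list, indexed from 0.  The weight at position \<open>\<tau>\<close>, one past
  the end, is \<open>l $ j\<close>; thus the condition at \<open>s = \<tau> - 1\<close> below says that the last weight is at
  least \<open>l $ j\<close>.\<close>

definition seq_weight ::
    "real ^ 'k::finite ^ 'n::finite \<Rightarrow> real ^ 'k \<Rightarrow> 'k \<Rightarrow> 'n list \<Rightarrow> nat \<Rightarrow> real"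
  where "seq_weight W l j js s = (if s < length js then W $ (js ! s) $ j else l $ j)"

definition mixing_sequence ::
    "real ^ 'k::finite ^ 'n::finite \<Rightarrow> real ^ 'k \<Rightarrow> 'k \<Rightarrow> 'n list \<Rightarrow> bool"
  where "mixing_sequence W l j js \<longleftrightarrow>
    js \<noteq> [] \<and> (\<forall>s<length js. seq_weight W l j js s \<ge> seq_weight W l j js (Suc s))"

definition mixing_sum ::
    "real ^ 'k::finite ^ 'n::finite \<Rightarrow> real ^ 'k \<Rightarrow> 'k \<Rightarrow> 'n list \<Rightarrow> real ^ 'n \<Rightarrow> real"
  where "mixing_sum W l j js z =
    (\<Sum>s<length js. (seq_weight W l j js s - seq_weight W l j js (Suc s)) * z $ (js ! s))"

definition mixing_inequality ::
    "real ^ 'k::finite ^ 'n::finite \<Rightarrow> real ^ 'k \<Rightarrow> 'k \<Rightarrow> 'n list \<Rightarrow> real ^ 'k \<Rightarrow> real ^ 'n \<Rightarrow> bool"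
  where "mixing_inequality W l j js y z \<longleftrightarrow>
    y $ j + mixing_sum W l j js z \<ge> W $ (hd js) $ j"

end

theory Submission imports Defs begin

text \<open>
  Put \<open>u i = W $ i $ j - l $ j\<close>.  At characteristic vectors the normalized function is
  \<open>V \<mapsto> max 0 (max i\<in>V. u i)\<close>, so the extended polymatroid bounds each sum of \<open>\<pi>\<close> over \<open>V\<close> by the
  peak of \<open>u\<close> on \<open>V\<close>.  Call \<open>V\<close> tight if this bound is attained.  No nonzero direction can be
  orthogonal to all tight sets at an extreme point (\<open>extreme_point_direction_eq_0\<close>).  Applied to
  \<open>e\<^sub>i\<close>, this puts every index into some tight set; applied to \<open>e\<^sub>i - e\<^sub>k\<close>, it separates any two
  indices by a tight set.

  Monotonicity of the peak then gives \<open>\<pi> \<ge> 0\<close>, and the tight set containing a maximizer of \<open>u\<close>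
  shows that \<open>\<pi>\<close> sums up to the overall peak.  List the support of \<open>\<pi>\<close> by decreasing \<open>u\<close>.  A tight
  set separating two neighbours in the list contains the lower one, misses the higher one and lies,
  within the support, in the tail starting at the lower one; hence the sum of \<open>\<pi>\<close> over that tail is
  \<open>u\<close> at its head (\<open>extreme_point_tail_sum\<close>).  Differences of consecutive tail sums
  are the individual entries of \<open>\<pi>\<close>, and they are exactly the coefficients of the mixing inequality.
\<close>

section \<open>Extreme points of an extended polymatroid\<close>

text \<open>
  Finitely many constraints define the set, and those with slack survive a small move.  So if \<open>d\<close>
  kept all tight constraints tight, then \<open>\<pi>\<close> would be the midpoint of \<open>\<pi> + t d\<close> and \<open>\<pi> - t d\<close> for
  some small \<open>t > 0\<close>.
\<close>

lemma extreme_point_direction_eq_0: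
  fixes f :: "real ^ 'n::finite \<Rightarrow> real" and d :: "real ^ 'n"
  assumes ext: "\<pi> extreme_point_of extended_polymatroid f"
    and tight: "\<And>V. (\<Sum>i\<in>V. \<pi> $ i) = f (char_vec V) \<Longrightarrow> (\<Sum>i\<in>V. d $ i) = 0"
  shows "d = 0"
proof (rule ccontr)
  assume "d \<noteq> 0"
  have le: "(\<Sum>i\<in>V. \<pi> $ i) \<le> f (char_vec V)" for V
    using ext by (auto simp: extreme_point_of_def extended_polymatroid_def)
  have "\<forall>\<^sub>F t in at_right 0. (\<Sum>i\<in>V. \<pi> $ i) + t * \<bar>\<Sum>i\<in>V. d $ i\<bar> \<le> f (char_vec V)" for V
  proof (cases "(\<Sum>i\<in>V. \<pi> $ i) = f (char_vec V)")
    case True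
    then show ?thesis using tight[OF True] by simp
  next
    case False
    have "((\<lambda>t. (\<Sum>i\<in>V. \<pi> $ i) + t * \<bar>\<Sum>i\<in>V. d $ i\<bar>) \<longlongrightarrow>
        (\<Sum>i\<in>V. \<pi> $ i) + 0 * \<bar>\<Sum>i\<in>V. d $ i\<bar>) (at_right 0)"
      by (intro tendsto_intros)
    moreover have "(\<Sum>i\<in>V. \<pi> $ i) + 0 * \<bar>\<Sum>i\<in>V. d $ i\<bar> < f (char_vec V)"
      using False le[of V] by simp
    ultimately have "\<forall>\<^sub>F t in at_right 0. (\<Sum>i\<in>V. \<pi> $ i) + t * \<bar>\<Sum>i\<in>V. d $ i\<bar> < f (char_vec V)"
      by (rule order_tendstoD(2))
    then show ?thesis by (rule eventually_mono) simp
  qed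
  then have "\<forall>\<^sub>F t in at_right 0. \<forall>V. (\<Sum>i\<in>V. \<pi> $ i) + t * \<bar>\<Sum>i\<in>V. d $ i\<bar> \<le> f (char_vec V)"
    by (rule eventually_all_finite)
  then have "\<forall>\<^sub>F t in at_right (0::real). 0 < t \<and>
      (\<forall>V. (\<Sum>i\<in>V. \<pi> $ i) + t * \<bar>\<Sum>i\<in>V. d $ i\<bar> \<le> f (char_vec V))"
    using eventually_at_right_less[of "0::real"] by (rule eventually_conj[rotated])
  then obtain t :: real where "t > 0"
    and t: "\<And>V. (\<Sum>i\<in>V. \<pi> $ i) + t * \<bar>\<Sum>i\<in>V. d $ i\<bar> \<le> f (char_vec V)"
    using eventually_happens trivial_limit_at_right_real by blast
  have mem: "\<pi> + s *\<^sub>R d \<in> extended_polymatroid f" if "\<bar>s\<bar> = t" for s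
  proof -
    have "(\<Sum>i\<in>V. (\<pi> + s *\<^sub>R d) $ i) \<le> f (char_vec V)" for V
    proof -
      have "(\<Sum>i\<in>V. (\<pi> + s *\<^sub>R d) $ i) = (\<Sum>i\<in>V. \<pi> $ i) + s * (\<Sum>i\<in>V. d $ i)"
        by (simp add: sum.distrib sum_distrib_left)
      also have "\<dots> \<le> (\<Sum>i\<in>V. \<pi> $ i) + t * \<bar>\<Sum>i\<in>V. d $ i\<bar>"
        using abs_ge_self[of "s * (\<Sum>i\<in>V. d $ i)"] that by (simp add: abs_mult)
      finally show ?thesis using t[of V] by linarith
    qed
    then show ?thesis by (simp add: extended_polymatroid_def)
  qed
  have "\<pi> = midpoint (\<pi> + t *\<^sub>R d) (\<pi> + (- t) *\<^sub>R d)"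
    by (simp add: midpoint_def scaleR_2[symmetric])
  moreover have "\<pi> + t *\<^sub>R d \<noteq> \<pi> + (- t) *\<^sub>R d"
  proof
    assume "\<pi> + t *\<^sub>R d = \<pi> + (- t) *\<^sub>R d"
    then have "t *\<^sub>R d = (- t) *\<^sub>R d" by (rule add_left_imp_eq)
    then show False using \<open>t > 0\<close> \<open>d \<noteq> 0\<close> by (subst (asm) scaleR_cancel_right) simp
  qed
  ultimately have "\<pi> \<in> open_segment (\<pi> + t *\<^sub>R d) (\<pi> + (- t) *\<^sub>R d)"
    by (metis midpoint_in_open_segment)
  then show False
    using ext mem[of t] mem[of "- t"] \<open>t > 0\<close> by (auto simp: extreme_point_of_def)
qed

lemma extreme_point_in_tight_set:
  fixes f :: "real ^ 'n::finite \<Rightarrow> real"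
  assumes "\<pi> extreme_point_of extended_polymatroid f"
  obtains V where "i \<in> V" "(\<Sum>k\<in>V. \<pi> $ k) = f (char_vec V)"
proof -
  have "\<exists>V. i \<in> V \<and> (\<Sum>k\<in>V. \<pi> $ k) = f (char_vec V)"
  proof (rule ccontr)
    assume "\<not> ?thesis"
    then have "axis i (1::real) = 0"
      by (intro extreme_point_direction_eq_0[OF assms] sum.neutral) (auto simp: axis_def)
    then show False by (simp add: axis_eq_0_iff)
  qed
  then show ?thesis using that by blast
qed

lemma extreme_point_separating_tight_set:
  fixes f :: "real ^ 'n::finite \<Rightarrow> real"
  assumes "\<pi> extreme_point_of extended_polymatroid f" and "i \<noteq> k"
  obtains V where "(i \<in> V) \<noteq> (k \<in> V)" "(\<Sum>m\<in>V. \<pi> $ m) = f (char_vec V)"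
proof -
  have "\<exists>V. (i \<in> V) \<noteq> (k \<in> V) \<and> (\<Sum>m\<in>V. \<pi> $ m) = f (char_vec V)"
  proof (rule ccontr)
    assume none: "\<not> ?thesis"
    have "axis i (1::real) - axis k 1 = 0"
    proof (rule extreme_point_direction_eq_0[OF assms(1)])
      fix V assume "(\<Sum>m\<in>V. \<pi> $ m) = f (char_vec V)"
      then have "(i \<in> V) = (k \<in> V)" using none by blast
      then show "(\<Sum>m\<in>V. (axis i (1::real) - axis k 1) $ m) = 0"
        by (simp add: axis_def sum_subtractf)
    qed
    then show False using assms(2) by (simp add: axis_eq_axis)
  qed
  then show ?thesis using that by blast
qed

section \<open>The peak of a weight function\<close>

definition peak :: "('n::finite \<Rightarrow> real) \<Rightarrow> 'n set \<Rightarrow> real"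
  where "peak u V = Max (insert 0 (u ` V))"

lemma peak_le_iff: "peak u V \<le> c \<longleftrightarrow> 0 \<le> c \<and> (\<forall>i\<in>V. u i \<le> c)"
  by (simp add: peak_def)

lemma peak_nonneg: "0 \<le> peak u V"
  using peak_le_iff[of u V "peak u V"] by simp

lemma le_peak: "i \<in> V \<Longrightarrow> u i \<le> peak u V"
  using peak_le_iff[of u V "peak u V"] by simp

lemma peak_mono: "U \<subseteq> V \<Longrightarrow> peak u U \<le> peak u V"
  by (auto simp: peak_le_iff peak_nonneg le_peak)

text \<open>
  Coordinates outside \<open>V\<close> enter the maximum as \<open>0\<close>; they are absorbed by \<open>l $ j\<close> because this is
  nonnegative.
\<close>

lemma normalized_mixing_fun_char_vec:
  fixes W :: "real ^ 'k::finite ^ 'n::finite"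
  assumes "l $ j \<ge> 0"
  shows "normalized (mixing_fun W l j) (char_vec V) = peak (\<lambda>i. W $ i $ j - l $ j) V"
proof -
  have le: "mixing_fun W l j (char_vec V) \<le> c \<longleftrightarrow> l $ j \<le> c \<and> (\<forall>i\<in>V. W $ i $ j \<le> c)" for V c
    using assms by (auto simp: mixing_fun_def char_vec_def indicator_def)
  have "mixing_fun W l j (char_vec V) = l $ j + peak (\<lambda>i. W $ i $ j - l $ j) V" for V
  proof -
    have "mixing_fun W l j (char_vec V) \<le> c \<longleftrightarrow> l $ j + peak (\<lambda>i. W $ i $ j - l $ j) V \<le> c" for c
      using le[of V c] peak_le_iff[of "\<lambda>i. W $ i $ j - l $ j" V "c - l $ j"]
      by (auto simp: algebra_simps)
    then show ?thesis by (meson antisym order_refl)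
  qed
  moreover have "peak (\<lambda>i. W $ i $ j - l $ j) {} = 0" by (simp add: peak_def)
  ultimately show ?thesis by (simp add: normalized_def)
qed

section \<open>Extreme points for a peak function\<close>

context
  fixes f :: "real ^ 'n::finite \<Rightarrow> real" and u :: "'n \<Rightarrow> real" and \<pi> :: "real ^ 'n"
  assumes f_peak: "\<And>V. f (char_vec V) = peak u V"
    and ext: "\<pi> extreme_point_of extended_polymatroid f"
begin

lemma extreme_point_sum_le_peak: "(\<Sum>i\<in>V. \<pi> $ i) \<le> peak u V"
  using ext by (auto simp: extreme_point_of_def extended_polymatroid_def f_peak)

text \<open>
  Removing \<open>i\<close> from a tight set does not raise the bound, so it cannot raise the sum.
\<close>

lemma extreme_point_nonneg: "0 \<le> \<pi> $ i"
proof -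
  obtain V where V: "i \<in> V" "(\<Sum>k\<in>V. \<pi> $ k) = peak u V"
    using extreme_point_in_tight_set[OF ext] f_peak by metis
  have "(\<Sum>k\<in>V. \<pi> $ k) = \<pi> $ i + (\<Sum>k\<in>V - {i}. \<pi> $ k)"
    using V(1) by (simp add: sum.remove)
  moreover have "(\<Sum>k\<in>V - {i}. \<pi> $ k) \<le> peak u V"
    using extreme_point_sum_le_peak[of "V - {i}"] peak_mono[of "V - {i}" V u] by auto
  ultimately show ?thesis using V(2) by linarith
qed

lemma extreme_point_support_le: "0 < \<pi> $ i \<Longrightarrow> \<pi> $ i \<le> u i"
  using extreme_point_sum_le_peak[of "{i}"] by (simp add: peak_def)

lemma extreme_point_sum_UNIV: "(\<Sum>i\<in>UNIV. \<pi> $ i) = peak u UNIV"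
proof (rule antisym[OF extreme_point_sum_le_peak])
  have "u i \<le> (\<Sum>k\<in>UNIV. \<pi> $ k)" for i
  proof -
    obtain V where V: "i \<in> V" "(\<Sum>k\<in>V. \<pi> $ k) = peak u V"
      using extreme_point_in_tight_set[OF ext] f_peak by metis
    have "u i \<le> (\<Sum>k\<in>V. \<pi> $ k)" using V by (simp add: le_peak)
    also have "\<dots> \<le> (\<Sum>k\<in>UNIV. \<pi> $ k)"
      by (rule sum_mono2) (auto simp: extreme_point_nonneg)
    finally show ?thesis .
  qed
  then show "peak u UNIV \<le> (\<Sum>i\<in>UNIV. \<pi> $ i)"
    by (auto simp: peak_le_iff extreme_point_nonneg intro: sum_nonneg)
qed

text \<open>
  Adding an index of the support to a tight set raises the sum, so it must raise the peak.
\<close>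

lemma peak_less_outside_tight_set:
  assumes V: "(\<Sum>i\<in>V. \<pi> $ i) = peak u V" and k: "k \<notin> V" "0 < \<pi> $ k"
  shows "peak u V < u k"
proof (rule ccontr)
  assume "\<not> ?thesis"
  then have "peak u (insert k V) \<le> peak u V"
    by (auto simp: peak_le_iff peak_nonneg le_peak)
  moreover have "(\<Sum>i\<in>insert k V. \<pi> $ i) = \<pi> $ k + peak u V"
    using V k by simp
  ultimately show False
    using extreme_point_sum_le_peak[of "insert k V"] k(2) by linarith
qed

lemma extreme_point_tail_sum:
  assumes js: "distinct js" "set js = {i. 0 < \<pi> $ i}" "sorted_wrt (\<lambda>i k. u k \<le> u i) js"
    and s: "s < length js"
  shows "(\<Sum>i\<in>set (drop s js). \<pi> $ i) = u (js ! s)"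
proof (rule antisym)
  have pos: "0 < \<pi> $ (js ! t)" if "t < length js" for t
    using js(2) nth_mem[OF that] by auto
  have dec: "u (js ! t) \<le> u (js ! r)" if "r \<le> t" "t < length js" for r t
    using sorted_wrt_nth_less[OF js(3), of r t] that by (cases "r = t") auto
  have in_tail: "\<exists>t\<ge>s. t < length js \<and> i = js ! t" if "i \<in> set (drop s js)" for i
    using that s by (auto simp: in_set_conv_nth) (metis add.commute le_add1 less_diff_conv)
  have "peak u (set (drop s js)) \<le> u (js ! s)"
    using pos[OF s] extreme_point_support_le[OF pos[OF s]] in_tail
    by (fastforce simp: peak_le_iff intro: dec)
  then show "(\<Sum>i\<in>set (drop s js). \<pi> $ i) \<le> u (js ! s)"
    using extreme_point_sum_le_peak[of "set (drop s js)"] by linarith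
  \<comment> \<open>For the head of the list, the whole index set takes the role of the separating tight set.\<close>
  obtain V where V: "js ! s \<in> V" "(\<Sum>i\<in>V. \<pi> $ i) = peak u V"
    and above: "\<And>t. t < s \<Longrightarrow> js ! t \<notin> V"
  proof (cases s)
    case 0
    then show ?thesis using that[of UNIV] extreme_point_sum_UNIV by simp
  next
    case (Suc r)
    then have r: "r < length js" "js ! r \<noteq> js ! s"
      using s js(1) by (auto simp: nth_eq_iff_index_eq)
    then obtain V where sep: "(js ! r \<in> V) \<noteq> (js ! s \<in> V)" and V: "(\<Sum>i\<in>V. \<pi> $ i) = peak u V"
      using extreme_point_separating_tight_set[OF ext] f_peak by metis
    have out: "js ! r \<notin> V"
    proof
      assume "js ! r \<in> V"
      then have "peak u V < u (js ! s)" "u (js ! r) \<le> peak u V"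
        using sep peak_less_outside_tight_set[OF V _ pos[OF s]] by (auto simp: le_peak)
      then show False using dec[of r s] Suc s by simp
    qed
    have "js ! t \<notin> V" if "t < s" for t
    proof
      assume "js ! t \<in> V"
      then have "u (js ! t) \<le> peak u V" by (rule le_peak)
      also have "\<dots> < u (js ! r)" by (rule peak_less_outside_tight_set[OF V out pos[OF r(1)]])
      finally show False using dec[of t r] that Suc r(1) by simp
    qed
    then show ?thesis using that[of V] sep out V by blast
  qed
  have "u (js ! s) \<le> (\<Sum>i\<in>V. \<pi> $ i)" using V by (simp add: le_peak)
  also have "\<dots> = (\<Sum>i\<in>V \<inter> set js. \<pi> $ i)"
  proof (rule sum.mono_neutral_right)
    show "\<forall>i\<in>V - V \<inter> set js. \<pi> $ i = 0"
      using js(2) extreme_point_nonneg by (auto simp: less_le)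
  qed auto
  also have "\<dots> \<le> (\<Sum>i\<in>set (drop s js). \<pi> $ i)"
  proof (rule sum_mono2)
    show "V \<inter> set js \<subseteq> set (drop s js)"
    proof
      fix i assume "i \<in> V \<inter> set js"
      then obtain t where t: "t < length js" "i = js ! t" "js ! t \<in> V"
        by (auto simp: in_set_conv_nth)
      then have "s \<le> t" using above[of t] by (meson not_le)
      then show "i \<in> set (drop s js)"
        using t by (auto simp: in_set_conv_nth intro!: exI[of _ "t - s"])
    qed
  qed (auto simp: extreme_point_nonneg)
  finally show "u (js ! s) \<le> (\<Sum>i\<in>set (drop s js). \<pi> $ i)" .
qed

lemma extreme_point_entry:
  assumes js: "distinct js" "set js = {i. 0 < \<pi> $ i}" "sorted_wrt (\<lambda>i k. u k \<le> u i) js"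
    and s: "s < length js"
  shows "\<pi> $ (js ! s) = u (js ! s) - (if Suc s < length js then u (js ! Suc s) else 0)"
proof -
  have drop: "drop s js = js ! s # drop (Suc s) js"
    using s by (rule Cons_nth_drop_Suc[symmetric])
  moreover have "distinct (drop s js)" using js(1) by simp
  ultimately have "(\<Sum>i\<in>set (drop s js). \<pi> $ i) = \<pi> $ (js ! s) + (\<Sum>i\<in>set (drop (Suc s) js). \<pi> $ i)"
    by simp
  then show ?thesis
    using extreme_point_tail_sum[OF js s] extreme_point_tail_sum[OF js, of "Suc s"] by auto
qed

end

section \<open>The mixing sequence of an extreme point\<close>

lemma peak_UNIV_eq_Max:
  fixes w :: "'n::finite \<Rightarrow> real"
  assumes "c \<le> (MAX i. w i)"
  shows "peak (\<lambda>i. w i - c) UNIV = (MAX i. w i) - c"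
proof (rule antisym)
  show "peak (\<lambda>i. w i - c) UNIV \<le> (MAX i. w i) - c"
    using assms by (simp add: peak_le_iff)
  have "w i \<le> peak (\<lambda>i. w i - c) UNIV + c" for i
    using le_peak[of i UNIV "\<lambda>i. w i - c"] by simp
  then show "(MAX i. w i) - c \<le> peak (\<lambda>i. w i - c) UNIV"
    by (simp add: diff_le_eq)
qed

theorem proposition3:
  fixes W :: "real ^ 'k::finite ^ 'n::finite" and l :: "real ^ 'k" and j :: 'k and \<pi> :: "real ^ 'n"
  assumes W_nonneg: "\<And>i j. W $ i $ j \<ge> 0"
    and l_nonneg: "\<And>j. l $ j \<ge> 0"
    and l_le_max: "l $ j \<le> (MAX i. W $ i $ j)"
    and extreme: "\<pi> extreme_point_of extended_polymatroid (normalized (mixing_fun W l j))"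
  shows "\<exists>js. mixing_sequence W l j js
    \<and> W $ (hd js) $ j = (MAX i. W $ i $ j)
    \<and> (\<forall>y z. polymatroid_inequality l j \<pi> y z \<longleftrightarrow> mixing_inequality W l j js y z)
    \<and> (\<forall>z. (\<Sum>i\<in>UNIV. \<pi> $ i * z $ i) = mixing_sum W l j js z)
    \<and> l $ j + (\<Sum>i\<in>UNIV. \<pi> $ i) = (MAX i. W $ i $ j)"
proof -
  define u where "u i = W $ i $ j - l $ j" for i
  have f_peak: "normalized (mixing_fun W l j) (char_vec V) = peak u V" for V
    unfolding u_def by (rule normalized_mixing_fun_char_vec[OF l_nonneg])
  have nonneg: "0 \<le> \<pi> $ i" for i
    by (rule extreme_point_nonneg[OF f_peak extreme])
  have total: "(\<Sum>i\<in>UNIV. \<pi> $ i) = (MAX i. W $ i $ j) - l $ j"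
    using extreme_point_sum_UNIV[OF f_peak extreme] peak_UNIV_eq_Max[OF l_le_max]
    by (simp add: u_def[abs_def])
  have "\<exists>js. mixing_sequence W l j js \<and> W $ (hd js) $ j = (MAX i. W $ i $ j)
    \<and> (\<forall>z. (\<Sum>i\<in>UNIV. \<pi> $ i * z $ i) = mixing_sum W l j js z)"
  proof (cases "{i. 0 < \<pi> $ i} = {}")
    case True
    \<comment> \<open>Here the maximum weight is \<open>l $ j\<close>, and a mixing sequence still has to be nonempty: a single
      maximizer, with coefficient 0.\<close>
    then have zero: "\<pi> $ i = 0" for i
      using nonneg[of i] by (auto simp: less_le)
    obtain m where m: "W $ m $ j = (MAX i. W $ i $ j)"
      using Max_in[of "range (\<lambda>i. W $ i $ j)"] by fastforce
    have "mixing_sequence W l j [m]" "mixing_sum W l j [m] z = 0" for z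
      using m total zero by (simp_all add: mixing_sequence_def mixing_sum_def seq_weight_def)
    then show ?thesis using m zero by (intro exI[of _ "[m]"]) simp
  next
    case False
    obtain xs where xs: "set xs = {i. 0 < \<pi> $ i}" "distinct xs"
      using finite_distinct_list[of "{i. 0 < \<pi> $ i}"] by auto
    define js where "js = sort_key (\<lambda>i. - u i) xs"
    have "sorted (map (\<lambda>i. - u i) js)" by (simp add: js_def)
    then have js: "distinct js" "set js = {i. 0 < \<pi> $ i}" "sorted_wrt (\<lambda>i k. u k \<le> u i) js"
      using xs by (auto simp: js_def sorted_wrt_map)
    have ne: "js \<noteq> []" using js(2) False by auto
    have entry: "\<pi> $ (js ! s) = seq_weight W l j js s - seq_weight W l j js (Suc s)"
      if "s < length js" for s
      using extreme_point_entry[OF f_peak extreme js that] that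
      by (simp add: seq_weight_def u_def split: if_splits)
    have "mixing_sequence W l j js"
      unfolding mixing_sequence_def using ne entry nonneg by (metis diff_ge_0_iff_ge)
    moreover have "W $ (hd js) $ j = (MAX i. W $ i $ j)"
    proof -
      have "(\<Sum>i\<in>set js. \<pi> $ i) = (\<Sum>i\<in>UNIV. \<pi> $ i)"
        using js(2) nonneg by (intro sum.mono_neutral_left) (auto simp: less_le)
      then show ?thesis
        using extreme_point_tail_sum[OF f_peak extreme js, of 0] ne total
        by (simp add: u_def hd_conv_nth)
    qed
    moreover have "(\<Sum>i\<in>UNIV. \<pi> $ i * z $ i) = mixing_sum W l j js z" for z
    proof -
      have "(\<Sum>i\<in>UNIV. \<pi> $ i * z $ i) = (\<Sum>i\<in>set js. \<pi> $ i * z $ i)"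
        using js(2) nonneg by (intro sum.mono_neutral_right) (auto simp: less_le)
      also have "\<dots> = (\<Sum>s<length js. \<pi> $ (js ! s) * z $ (js ! s))"
        by (rule sum.reindex_bij_betw[symmetric, OF bij_betw_nth[OF js(1)]]) auto
      also have "\<dots> = mixing_sum W l j js z"
        unfolding mixing_sum_def by (intro sum.cong) (simp_all add: entry)
      finally show ?thesis .
    qed
    ultimately show ?thesis by blast
  qed
  then show ?thesis
    using total by (auto simp: polymatroid_inequality_def mixing_inequality_def)
qed

end
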